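(* Let $\mathcal{H}$ and $\mathcal{K}$ be real Hilbert spaces, let $f:\mathcal{H}\to\mathbb{R}$ be a convex and differentiable function with $L_{\nabla f}$-Lipschitz continuous gradient, $g:\mathcal{K}\to\mathbb{R}$ a convex and $L_g$-Lipschitz continuous function, $K:\mathcal{H}\to\mathcal{K}$ a nonzero linear continuous operator, and let $x^*\in\mathcal{H}$ be an optimal solution to the problem $$(P)\qquad \inf_{x\in\mathcal{H}}\{f(x)+g(Kx)\}.$$ Then, when choosing for $\varepsilon>0$ $$\mu=\frac{\varepsilon}{L_g^2},$$ the algorithm Initialization: $t_1=1$, $y_1=x_0\in\mathcal{H}$, $L(\mu)=L_{\nabla f}+\frac{\|K\|^2}{\mu}$; For $k\ge 1$: $$x_k=y_k-\frac{1}{L(\mu)}\left(\nabla f(y_k)+K^*\,\mathrm{Prox}_{\frac{1}{\mu}g^*}\left(\frac{Ky_k}{\mu}\right)\right),$$ $$t_{k+1}=\frac{1+\sqrt{1+4t_k^2}}{2},\qquad y_{k+1}=x_k+\frac{t_k-1}{t_{k+1}}(x_k-x_{k-1}),$$ generates a sequence $(x_k)_{k\ge1}\subseteq\mathcal{H}$ which provides an $\varepsilon$-optimal solution to $(P)$ with a rate of convergence for the objective of order $\mathcal{O}\left(\frac1k\right)$.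
   Context: The objective of $(P)$ is $F:\mathcal{H}\to\mathbb{R}$, $F(x)=f(x)+g(Kx)$; a point $x$ is $\varepsilon$-optimal if $F(x)-F(x^* )\le\varepsilon$. For a function $h$ on a real Hilbert space $\mathcal{X}$, $h^*(p)=\sup_{x\in\mathcal{X}}\{\langle p,x\rangle-h(x)\}$ denotes its conjugate. For a proper, convex, lower semicontinuous $h:\mathcal{X}\to\mathbb{R}\cup\{+\infty\}$ and $\gamma>0$, $\mathrm{Prox}_{\gamma h}(x)$ denotes the unique minimizer over $y\in\mathcal{X}$ of $h(y)+\frac{1}{2\gamma}\|y-x\|^2$. $K^*$ is the adjoint operator of $K$ and $\|K\|$ is the operator norm of $K$. The Lipschitz constant $L_g$ is positive, as the choice of $\mu$ requires. *)

theory Defs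
  imports "HOL-Analysis.Analysis"
begin

definition objective :: "('h \<Rightarrow> real) \<Rightarrow> ('k \<Rightarrow> real) \<Rightarrow> ('h \<Rightarrow> 'k) \<Rightarrow> 'h \<Rightarrow> real" where
  "objective f g K x = f x + g (K x)"

definition fenchel_conjugate :: "('a::real_inner \<Rightarrow> ereal) \<Rightarrow> 'a \<Rightarrow> ereal" where
  "fenchel_conjugate h p = (SUP x. ereal (p \<bullet> x) - h x)"

text \<open>
  The proximal point of \<open>\<gamma> h\<close> at \<open>x\<close>. It is meaningful for \<open>\<gamma> > 0\<close> and a proper, convex, lower
  semicontinuous \<open>h\<close> on a Hilbert space, where the minimizer exists and is unique.
\<close>
definition prox :: "real \<Rightarrow> ('a::real_inner \<Rightarrow> ereal) \<Rightarrow> 'a \<Rightarrow> 'a" where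
  "prox \<gamma> h x =
    (THE y. is_arg_min (\<lambda>y. h y + ereal (1 / (2 * \<gamma>) * (norm (y - x))\<^sup>2)) (\<lambda>_. True) y)"

text \<open>
  The sequences \<open>x\<close>, \<open>y\<close>, \<open>t\<close> are produced by the accelerated scheme with constant smoothing
  parameter \<open>\<mu>\<close>, started at \<open>x0\<close>; \<open>df\<close> is the gradient of the smooth part and \<open>Lf\<close> its Lipschitz
  constant. The values \<open>y 0\<close> and \<open>t 0\<close> play no role.
\<close>
definition generated_by_smoothing ::
  "('h::real_inner \<Rightarrow> 'h) \<Rightarrow> real \<Rightarrow> ('k::real_inner \<Rightarrow> real) \<Rightarrow> ('h \<Rightarrow> 'k) \<Rightarrow> real \<Rightarrow> 'h \<Rightarrow>
    (nat \<Rightarrow> 'h) \<Rightarrow> (nat \<Rightarrow> 'h) \<Rightarrow> (nat \<Rightarrow> real) \<Rightarrow> bool" where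
  "generated_by_smoothing df Lf g K \<mu> x0 x y t \<longleftrightarrow>
    (let L = Lf + (onorm K)\<^sup>2 / \<mu> in
      t 1 = 1 \<and> x 0 = x0 \<and> y 1 = x0 \<and>
      (\<forall>k\<ge>1.
        x k = y k - (1 / L) *\<^sub>R
          (df (y k) + adjoint K (prox (1 / \<mu>) (fenchel_conjugate (\<lambda>z. ereal (g z))) (K (y k) /\<^sub>R \<mu>))) \<and>
        t (k + 1) = (1 + sqrt (1 + 4 * (t k)\<^sup>2)) / 2 \<and>
        y (k + 1) = x k + ((t k - 1) / t (k + 1)) *\<^sub>R (x k - x (k - 1))))"

end

(* The point p(z) = Prox_{g^*/mu}(z/mu) is a subgradient of g at z - mu p(z), and it is the gradient
   of the Moreau envelope of g, a convex function with 1/mu-Lipschitz gradient lying within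
   mu Lg^2/2 below g.  The algorithm is therefore Nesterov's accelerated gradient method for f plus
   the envelope composed with K, whose values converge at rate 2 L(mu) |x0 - xs|^2 / k^2; for
   mu = eps/Lg^2 the smoothing error is eps/2 and the rate is at most eps/2 once k >= C/eps. *)
theory Submission
  imports Defs
begin

section \<open>Minimizers of strongly convex functions, Riesz representation and adjoints\<close>

text \<open>Replaces the limit \<open>s -> 0\<close> when a first-order condition is read off from
  minimality along a segment.\<close>

lemma nonneg_if_nonneg_small_perturbation:
  fixes a b :: real
  assumes "\<And>s. 0 < s \<Longrightarrow> s \<le> 1 \<Longrightarrow> 0 \<le> b + a * s"
  shows "0 \<le> b"
proof (rule ccontr)
  assume "\<not> 0 \<le> b"
  \<comment> \<open>Small enough that \<open>a * s\<close> makes up for at most half of the deficit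
    \<open>- b\<close>.\<close>
  define s where "s = min 1 (- b / (2 * (\<bar>a\<bar> + 1)))"
  have "0 < s" "s \<le> 1" using \<open>\<not> 0 \<le> b\<close> by (auto simp: s_def field_simps)
  have "s \<le> - b / (2 * (\<bar>a\<bar> + 1))" by (simp add: s_def)
  then have "(\<bar>a\<bar> + 1) * s \<le> - b / 2" by (simp add: field_simps)
  moreover have "a * s \<le> (\<bar>a\<bar> + 1) * s" using \<open>0 < s\<close> by (intro mult_right_mono) auto
  ultimately show False using assms[OF \<open>0 < s\<close> \<open>s \<le> 1\<close>] \<open>\<not> 0 \<le> b\<close> by linarith
qed

text \<open>A minimizing sequence is Cauchy: midpoints cannot go below the infimum \<open>m\<close>,
  so \<open>mid\<close> bounds \<open>c\<close> times the squared distance of two terms by their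
  average excess over \<open>m\<close>. Completeness and continuity do the rest.\<close>

lemma strongly_midconvex_minimizer:
  fixes h :: "'a::{real_normed_vector, complete_space} \<Rightarrow> real"
  assumes cont: "continuous_on UNIV h" and bdd: "bdd_below (range h)" and "c > 0"
    and mid: "\<And>x y. h ((x + y) /\<^sub>R 2) \<le> (h x + h y) / 2 - c * (norm (x - y))\<^sup>2"
  obtains x where "\<And>y. h x \<le> h y"
proof -
  define m where "m = Inf (range h)"
  have lower: "m \<le> h y" for y unfolding m_def using bdd by (intro cInf_lower) auto
  have "\<exists>y. h y < m + 1 / (real n + 1)" for n
    using cInf_lessD[of "range h" "m + 1 / (real n + 1)"] unfolding m_def by auto
  then obtain s where s: "\<And>n. h (s n) < m + 1 / (real n + 1)" by metis
  have tail: "c * (norm (s i - s j))\<^sup>2 \<le> 1 / (real n + 1)" if "i \<ge> n" "j \<ge> n" for i j n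
  proof -
    define \<delta> where "\<delta> = 1 / (real n + 1)"
    have "h (s l) \<le> m + \<delta>" if "l \<ge> n" for l
    proof -
      have "1 / (real l + 1) \<le> \<delta>" unfolding \<delta>_def using that by (intro divide_left_mono) auto
      then show ?thesis using s[of l] by linarith
    qed
    from this[OF that(1)] this[OF that(2)] show ?thesis
      using mid[of "s i" "s j"] lower[of "(s i + s j) /\<^sub>R 2"]
      unfolding \<delta>_def[symmetric] by argo
  qed
  have "Cauchy s"
  proof (rule CauchyI)
    fix e :: real assume "0 < e"
    then obtain n where n: "inverse (real (Suc n)) < c * e\<^sup>2"
      using reals_Archimedean[of "c * e\<^sup>2"] \<open>c > 0\<close> by auto
    have "norm (s i - s j) < e" if "i \<ge> n" "j \<ge> n" for i j
    proof -
      have "c * (norm (s i - s j))\<^sup>2 < c * e\<^sup>2"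
        using tail[OF that] n by (simp add: inverse_eq_divide add.commute)
      then have "(norm (s i - s j))\<^sup>2 < e\<^sup>2" using \<open>c > 0\<close> by simp
      then show ?thesis using \<open>0 < e\<close> by (meson less_eq_real_def power_less_imp_less_base)
    qed
    then show "\<exists>M. \<forall>i\<ge>M. \<forall>j\<ge>M. norm (s i - s j) < e" by blast
  qed
  then obtain x where "s \<longlonglongrightarrow> x" using Cauchy_convergent_iff convergent_def by blast
  then have 1: "(\<lambda>n. h (s n)) \<longlonglongrightarrow> h x"
    using cont by (simp add: continuous_on_eq_continuous_at isCont_tendsto_compose)
  have 2: "(\<lambda>n. m + 1 / (real n + 1)) \<longlonglongrightarrow> m + 0"
    using LIMSEQ_inverse_real_of_nat
    by (intro tendsto_add tendsto_const) (simp add: inverse_eq_divide add.commute)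
  have "h x \<le> m + 0"
    by (rule LIMSEQ_le[OF 1 2]) (use s less_imp_le in blast)
  then show thesis using lower that by (metis add.right_neutral order_trans)
qed

text \<open>Parallelogram law for \<open>x - z\<close> and \<open>y - z\<close>. The last term
  yields the constant \<open>c\<close> of strong midconvexity: 1/8 for half a square,
  \<open>1 / (8 * \<mu>)\<close> for a square over \<open>2 * \<mu>\<close>.\<close>

lemma norm_midpoint_diff:
  fixes x y z :: "'a::real_inner"
  shows "(norm ((x + y) /\<^sub>R 2 - z))\<^sup>2
    = ((norm (x - z))\<^sup>2 + (norm (y - z))\<^sup>2) / 2 - (norm (x - y))\<^sup>2 / 4"
  unfolding power2_norm_eq_inner by (simp add: inner_simps inner_commute field_simps)

text \<open>The representing vector is the minimizer of \<open>|x|^2 / 2 - \<phi> x\<close>, whose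
  stationarity condition is the claim.\<close>

lemma riesz_representation:
  fixes \<phi> :: "'a::{real_inner, complete_space} \<Rightarrow> real"
  assumes "bounded_linear \<phi>"
  obtains z where "\<And>x. \<phi> x = x \<bullet> z"
proof -
  interpret bounded_linear \<phi> by fact
  \<comment> \<open>The \<open>- 0\<close> gives the square the shape that
    \<open>norm_midpoint_diff\<close> rewrites.\<close>
  define h where "h x = (norm (x - 0))\<^sup>2 / 2 - \<phi> x" for x
  obtain z where z: "\<And>y. h z \<le> h y"
  proof (rule strongly_midconvex_minimizer[of h "1 / 8"])
    show "continuous_on UNIV h"
      unfolding h_def by (intro continuous_intros continuous_on) auto
    have "- (onorm \<phi>)\<^sup>2 / 2 \<le> h x" for x
    proof -
      have "\<phi> x \<le> onorm \<phi> * norm x" using onorm[OF assms, of x] by simp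
      moreover have "0 \<le> (norm x - onorm \<phi>)\<^sup>2" by simp
      ultimately show ?thesis by (simp add: h_def power2_diff field_simps)
    qed
    then show "bdd_below (range h)" by (meson bdd_belowI2)
    show "h ((x + y) /\<^sub>R 2) \<le> (h x + h y) / 2 - 1 / 8 * (norm (x - y))\<^sup>2" for x y
      unfolding h_def norm_midpoint_diff by (simp add: scaleR add field_simps)
  qed auto
  \<comment> \<open>Minimality gives only an inequality in each direction; the directions
    \<open>x\<close> and \<open>- x\<close> together give equality.\<close>
  have half: "0 \<le> z \<bullet> x - \<phi> x" for x
  proof (rule nonneg_if_nonneg_small_perturbation)
    fix s :: real assume "0 < s"
    have "0 \<le> s * ((z \<bullet> x - \<phi> x) + (norm x)\<^sup>2 / 2 * s)"
      using z[of "z + s *\<^sub>R x"] unfolding h_def power2_norm_eq_inner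
      by (simp add: inner_simps inner_commute add scaleR algebra_simps)
    with \<open>0 < s\<close> show "0 \<le> (z \<bullet> x - \<phi> x) + (norm x)\<^sup>2 / 2 * s"
      by (simp add: zero_le_mult_iff)
  qed
  have "\<phi> x = x \<bullet> z" for x
    using half[of x] half[of "- x"] by (simp add: neg inner_commute)
  then show thesis by (rule that)
qed

text \<open>\<open>adjoint\<close> is a choice operator, so its identity holds once some adjoint
  exists; Riesz provides one separately for each \<open>y\<close>.\<close>

lemma inner_adjoint:
  fixes K :: "'h::{real_inner, complete_space} \<Rightarrow> 'k::real_inner"
  assumes "bounded_linear K"
  shows "adjoint K y \<bullet> x = y \<bullet> K x"
proof -
  have "\<exists>z. \<forall>x. K x \<bullet> y = x \<bullet> z" for y
    using riesz_representation[OF bounded_linear_inner_left_comp[OF assms, of y]] by metis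
  then have "\<exists>K'. \<forall>x y. K x \<bullet> y = x \<bullet> K' y" by metis
  then have "\<forall>x y. K x \<bullet> y = x \<bullet> adjoint K y" unfolding adjoint_def by (rule someI_ex)
  then show ?thesis by (simp add: inner_commute)
qed

section \<open>Proximal points, subgradients and conjugates\<close>

text \<open>The hypothesis says that \<open>(x - p) / \<gamma>\<close> is a subgradient of \<open>h\<close> at \<open>p\<close>.\<close>
lemma prox_eqI:
  fixes x p :: "'a::real_inner"
  assumes "\<gamma> > 0" and hp: "h p = ereal c"
    and sub: "\<And>q. ereal (c + ((x - p) /\<^sub>R \<gamma>) \<bullet> (q - p)) \<le> h q"
  shows "prox \<gamma> h x = p"
proof -
  let ?H = "\<lambda>y. h y + ereal (1 / (2 * \<gamma>) * (norm (y - x))\<^sup>2)"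
  \<comment> \<open>Expanding the square around \<open>p\<close>, the linear term cancels against
    the subgradient term. The surplus \<open>|q - p|^2\<close> yields uniqueness, which the
    \<open>THE\<close> in \<open>prox\<close> requires.\<close>
  have growth: "?H p + ereal (1 / (2 * \<gamma>) * (norm (q - p))\<^sup>2) \<le> ?H q" for q
  proof -
    have "?H p + ereal (1 / (2 * \<gamma>) * (norm (q - p))\<^sup>2)
        = ereal (c + ((x - p) /\<^sub>R \<gamma>) \<bullet> (q - p)) + ereal (1 / (2 * \<gamma>) * (norm (q - x))\<^sup>2)"
      using \<open>\<gamma> > 0\<close> unfolding hp power2_norm_eq_inner
      by (simp add: inner_simps inner_commute field_simps)
    also have "\<dots> \<le> ?H q" by (intro add_right_mono sub)
    finally show ?thesis .
  qed
  have least: "?H p \<le> ?H q" for q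
  proof -
    have "?H p \<le> ?H p + ereal (1 / (2 * \<gamma>) * (norm (q - p))\<^sup>2)" using \<open>\<gamma> > 0\<close> by (simp add: hp)
    then show ?thesis using growth by (rule order_trans)
  qed
  show ?thesis unfolding prox_def
  proof (rule the_equality)
    show "is_arg_min ?H (\<lambda>_. True) p" using least by (auto simp: is_arg_min_def not_less)
    fix q assume "is_arg_min ?H (\<lambda>_. True) q"
    then have "?H q \<le> ?H p" by (auto simp: is_arg_min_def not_less)
    with growth[of q] have "?H p + ereal (1 / (2 * \<gamma>) * (norm (q - p))\<^sup>2) \<le> ?H p"
      by (rule order_trans)
    then have "1 / (2 * \<gamma>) * (norm (q - p))\<^sup>2 \<le> 0" by (simp add: hp)
    with \<open>\<gamma> > 0\<close> show "q = p" by (simp add: divide_le_0_iff)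
  qed
qed

text \<open>An implicit gradient step: if \<open>w\<close> minimizes
  \<open>g w + |w - z|^2 / (2 * \<mu>)\<close>, then \<open>(z - w) / \<mu>\<close> is a subgradient
  of \<open>g\<close> at \<open>w\<close> itself.\<close>

lemma ex_backward_subgradient:
  fixes g :: "'k::{real_inner, complete_space} \<Rightarrow> real"
  assumes conv: "convex_on UNIV g" and lip: "L-lipschitz_on UNIV g" and "\<mu> > 0"
  obtains p where "\<And>v. g (z - \<mu> *\<^sub>R p) + p \<bullet> (v - (z - \<mu> *\<^sub>R p)) \<le> g v"
proof -
  define h where "h w = g w + (norm (w - z))\<^sup>2 / (2 * \<mu>)" for w
  obtain w where w: "\<And>y. h w \<le> h y"
  proof (rule strongly_midconvex_minimizer[of h "1 / (8 * \<mu>)"])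
    show "continuous_on UNIV h" unfolding h_def
      using lipschitz_on_continuous_on[OF lip] \<open>\<mu> > 0\<close> by (intro continuous_intros) auto
    \<comment> \<open>The quadratic \<open>r^2 / (2 * \<mu>) - L * r\<close> is least at
      \<open>r = \<mu> * L\<close>, whence the constant.\<close>
    have "g z - L\<^sup>2 * \<mu> / 2 \<le> h v" for v
    proof -
      have "g z - g v \<le> L * norm (v - z)"
        using lipschitz_onD[OF lip, of z v] by (simp add: dist_norm norm_minus_commute)
      moreover have "0 \<le> (norm (v - z) - \<mu> * L)\<^sup>2 / (2 * \<mu>)" using \<open>\<mu> > 0\<close> by simp
      then have "L * norm (v - z) \<le> (norm (v - z))\<^sup>2 / (2 * \<mu>) + L\<^sup>2 * \<mu> / 2"
        using \<open>\<mu> > 0\<close> by (simp add: power2_eq_square field_simps)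
      ultimately show ?thesis by (simp add: h_def)
    qed
    then show "bdd_below (range h)" by (meson bdd_belowI2)
    show "h ((x + y) /\<^sub>R 2) \<le> (h x + h y) / 2 - 1 / (8 * \<mu>) * (norm (x - y))\<^sup>2" for x y
    proof -
      have mid: "g ((x + y) /\<^sub>R 2) \<le> (g x + g y) / 2"
        using convex_onD[OF conv, of "1 / 2" x y] by (simp add: scaleR_add_right)
      have "((a + b) / 2 - c / 4) / (2 * \<mu>) = (a / (2 * \<mu>) + b / (2 * \<mu>)) / 2
          - 1 / (8 * \<mu>) * c" for a b c
        using \<open>\<mu> > 0\<close> by (simp add: field_simps)
      from this[of "(norm (x - z))\<^sup>2" "(norm (y - z))\<^sup>2" "(norm (x - y))\<^sup>2"] mid
      show ?thesis unfolding h_def norm_midpoint_diff by argo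
    qed
  qed (use \<open>\<mu> > 0\<close> in auto)
  define p where "p = (z - w) /\<^sub>R \<mu>"
  have zw: "z - \<mu> *\<^sub>R p = w" using \<open>\<mu> > 0\<close> by (simp add: p_def)
  \<comment> \<open>Moving \<open>w\<close> a fraction \<open>s\<close> towards \<open>v\<close> and
    using convexity of \<open>g\<close> leaves a first-order term plus an error of order
    \<open>s\<close>.\<close>
  have "0 \<le> g v - g w - p \<bullet> (v - w)" for v
  proof (rule nonneg_if_nonneg_small_perturbation)
    fix s :: real assume "0 < s" "s \<le> 1"
    have "g (w + s *\<^sub>R (v - w)) \<le> (1 - s) * g w + s * g v"
      using convex_onD[OF conv, of s w v] \<open>0 < s\<close> \<open>s \<le> 1\<close> by (simp add: algebra_simps)
    moreover have "(norm (w + s *\<^sub>R (v - w) - z))\<^sup>2 / (2 * \<mu>) = (norm (w - z))\<^sup>2 / (2 * \<mu>)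
        - s * (p \<bullet> (v - w)) + s * ((norm (v - w))\<^sup>2 / (2 * \<mu>) * s)"
      using \<open>\<mu> > 0\<close> unfolding p_def power2_norm_eq_inner
      by (simp add: inner_simps inner_commute field_simps)
    ultimately have "0 \<le> s * (g v - g w - p \<bullet> (v - w) + (norm (v - w))\<^sup>2 / (2 * \<mu>) * s)"
      using w[of "w + s *\<^sub>R (v - w)"] unfolding h_def by (simp add: algebra_simps)
    with \<open>0 < s\<close> show "0 \<le> g v - g w - p \<bullet> (v - w) + (norm (v - w))\<^sup>2 / (2 * \<mu>) * s"
      by (simp add: zero_le_mult_iff)
  qed
  then have "g w + p \<bullet> (v - w) \<le> g v" for v by (simp add: algebra_simps)
  then show thesis using zw by (intro that[of p]) simp
qed

text \<open>Equality case of Fenchel-Young: the subgradient inequality says that the supremum is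
  attained at \<open>w\<close>.\<close>

lemma fenchel_conjugate_at_subgradient:
  assumes "\<And>v. g w + p \<bullet> (v - w) \<le> g v"
  shows "fenchel_conjugate (\<lambda>z. ereal (g z)) p = ereal (p \<bullet> w - g w)"
  unfolding fenchel_conjugate_def
proof (rule antisym)
  show "(SUP x. ereal (p \<bullet> x) - ereal (g x)) \<le> ereal (p \<bullet> w - g w)"
    using assms by (intro SUP_least) (simp add: inner_simps algebra_simps)
  show "ereal (p \<bullet> w - g w) \<le> (SUP x. ereal (p \<bullet> x) - ereal (g x))"
    by (rule SUP_upper2[of w]) auto
qed

section \<open>The Moreau envelope of \<open>g\<close> and its gradient\<close>

text \<open>The vector to which the algorithm applies \<open>adjoint K\<close>, with
  \<open>z = K (y k)\<close>. Its role as a gradient is captured by the linear lower bound and the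
  quadratic upper bound below; the envelope is never differentiated.\<close>

definition smooth_grad :: "real \<Rightarrow> ('k::real_inner \<Rightarrow> real) \<Rightarrow> 'k \<Rightarrow> 'k" where
  "smooth_grad \<mu> g z = prox (1 / \<mu>) (fenchel_conjugate (\<lambda>z. ereal (g z))) (z /\<^sub>R \<mu>)"

text \<open>By Moreau's decomposition \<open>z - \<mu> p\<close> is the proximal point of \<open>\<mu> g\<close> at \<open>z\<close>, so the following
  is the Moreau envelope of \<open>g\<close> with parameter \<open>\<mu>\<close>.\<close>
definition smoothing :: "real \<Rightarrow> ('k::real_inner \<Rightarrow> real) \<Rightarrow> 'k \<Rightarrow> real" where
  "smoothing \<mu> g z =
    (let p = smooth_grad \<mu> g z in g (z - \<mu> *\<^sub>R p) + \<mu> / 2 * (norm p)\<^sup>2)"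

context
  fixes g :: "'k::{real_inner, complete_space} \<Rightarrow> real" and L \<mu> :: real
  assumes conv: "convex_on UNIV g" and lip: "L-lipschitz_on UNIV g" and \<mu>: "\<mu> > 0"
begin

text \<open>Subgradients invert under conjugation: if \<open>p\<close> is a subgradient of
  \<open>g\<close> at \<open>u = z - \<mu> p\<close>, then \<open>u\<close> is one of the conjugate
  at \<open>p\<close>, and this is the optimality condition of the dual proximal point. The bounds
  on the envelope use \<open>prox\<close> only through this fact.\<close>

lemma smooth_grad_subgradient:
  defines "w \<equiv> \<lambda>z. z - \<mu> *\<^sub>R smooth_grad \<mu> g z"
  shows "g (w z) + smooth_grad \<mu> g z \<bullet> (v - w z) \<le> g v"
proof -
  obtain p where p: "\<And>v. g (z - \<mu> *\<^sub>R p) + p \<bullet> (v - (z - \<mu> *\<^sub>R p)) \<le> g v"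
    using ex_backward_subgradient[OF conv lip \<mu>] by blast
  define u where "u = z - \<mu> *\<^sub>R p"
  have "smooth_grad \<mu> g z = p" unfolding smooth_grad_def
  proof (rule prox_eqI)
    show "fenchel_conjugate (\<lambda>z. ereal (g z)) p = ereal (p \<bullet> u - g u)"
      using p by (intro fenchel_conjugate_at_subgradient) (simp add: u_def)
    fix q
    have "(z /\<^sub>R \<mu> - p) /\<^sub>R (1 / \<mu>) = u" using \<mu> by (simp add: u_def scaleR_diff_right)
    then have "p \<bullet> u - g u + ((z /\<^sub>R \<mu> - p) /\<^sub>R (1 / \<mu>)) \<bullet> (q - p) = q \<bullet> u - g u"
      by (simp add: inner_simps inner_commute)
    then show "ereal (p \<bullet> u - g u + ((z /\<^sub>R \<mu> - p) /\<^sub>R (1 / \<mu>)) \<bullet> (q - p))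
        \<le> fenchel_conjugate (\<lambda>z. ereal (g z)) q"
      unfolding fenchel_conjugate_def by (intro SUP_upper2[of u]) auto
  qed (use \<mu> in simp)
  then show ?thesis using p by (simp add: w_def)
qed

text \<open>The subgradient inequality tested at \<open>z\<close> contributes
  \<open>\<mu> * |p|^2\<close>, of which the envelope keeps half.\<close>

lemma smoothing_le: "smoothing \<mu> g z \<le> g z"
proof -
  have "0 \<le> \<mu> * (smooth_grad \<mu> g z \<bullet> smooth_grad \<mu> g z)" using \<mu> by simp
  then show ?thesis
    using smooth_grad_subgradient[of z z] by (simp add: smoothing_def Let_def power2_norm_eq_inner)
qed

text \<open>The backward step has length \<open>\<mu> * |p|\<close>, so \<open>g\<close> drops by at
  most \<open>L * \<mu> * |p|\<close>; the maximum of \<open>L * \<mu> * r - \<mu> / 2 * r^2\<close>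
  over \<open>r\<close> is the stated gap.\<close>

lemma le_smoothing: "g z \<le> smoothing \<mu> g z + \<mu> * L\<^sup>2 / 2"
proof -
  let ?p = "smooth_grad \<mu> g z"
  have "g z - g (z - \<mu> *\<^sub>R ?p) \<le> L * (\<mu> * norm ?p)"
    using lipschitz_onD[OF lip, of z "z - \<mu> *\<^sub>R ?p"] \<mu> by (simp add: dist_norm)
  moreover have "0 \<le> \<mu> * (norm ?p - L)\<^sup>2" using \<mu> by simp
  ultimately show ?thesis by (simp add: smoothing_def Let_def power2_diff algebra_simps)
qed

text \<open>Testing the subgradient \<open>p\<close> at the backward point of \<open>v\<close> gives
  the claim with \<open>\<mu> / 2 * |p - q|^2\<close> to spare.\<close>

lemma smoothing_above_tangent:
  "smoothing \<mu> g z + smooth_grad \<mu> g z \<bullet> (v - z) \<le> smoothing \<mu> g v"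
proof -
  define p q where "p = smooth_grad \<mu> g z" and "q = smooth_grad \<mu> g v"
  have "0 \<le> \<mu> * (norm (p - q))\<^sup>2" using \<mu> by simp
  then show ?thesis
    using smooth_grad_subgradient[of z "v - \<mu> *\<^sub>R q"]
    unfolding smoothing_def Let_def p_def[symmetric] q_def[symmetric] power2_norm_eq_inner
    by (simp add: inner_simps inner_commute algebra_simps)
qed

text \<open>With \<open>z\<close> and \<open>v\<close> exchanged, the same test bounds the excess
  over the tangent by \<open>(q - p) \<bullet> (v - z) - \<mu> / 2 * |q - p|^2\<close>; completing
  the square removes \<open>q\<close>.\<close>

lemma smoothing_descent:
  "smoothing \<mu> g v \<le> smoothing \<mu> g z + smooth_grad \<mu> g z \<bullet> (v - z) + (norm (v - z))\<^sup>2 / (2 * \<mu>)"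
proof -
  define p q where "p = smooth_grad \<mu> g z" and "q = smooth_grad \<mu> g v"
  have "0 \<le> (norm ((v - z) - \<mu> *\<^sub>R (q - p)))\<^sup>2 / (2 * \<mu>)" using \<mu> by simp
  also have "\<dots> = (norm (v - z))\<^sup>2 / (2 * \<mu>) - (q - p) \<bullet> (v - z) + \<mu> / 2 * (norm (q - p))\<^sup>2"
    using \<mu> unfolding power2_norm_eq_inner by (simp add: inner_simps inner_commute field_simps)
  finally show ?thesis
    using smooth_grad_subgradient[of v "z - \<mu> *\<^sub>R p"]
    unfolding smoothing_def Let_def p_def[symmetric] q_def[symmetric] power2_norm_eq_inner
    by (simp add: inner_simps inner_commute algebra_simps)
qed

end

section \<open>Tangent and quadratic bounds for the smooth part\<close>

lemma GDERIV_along_line: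
  assumes "\<And>z. GDERIV f z :> df z"
  shows "((\<lambda>s. f (z + s *\<^sub>R d)) has_real_derivative df (z + s *\<^sub>R d) \<bullet> d) (at s)"
proof -
  have "((\<lambda>s. z + s *\<^sub>R d) has_derivative (\<lambda>s. s *\<^sub>R d)) (at s)"
    by (auto intro!: derivative_eq_intros)
  from has_derivative_compose[OF this assms[unfolded gderiv_def]] show ?thesis
    unfolding has_field_derivative_def by (simp add: inner_commute mult_commute_abs)
qed

lemma convex_on_above_tangent_GDERIV:
  fixes f :: "'h::real_inner \<Rightarrow> real"
  assumes conv: "convex_on UNIV f" and deriv: "\<And>z. GDERIV f z :> df z"
  shows "f z + df z \<bullet> (v - z) \<le> f v"
proof -
  let ?\<phi> = "\<lambda>s. f (z + s *\<^sub>R (v - z))"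
  have "convex_on UNIV ?\<phi>"
  proof (rule convex_onI)
    fix t a b :: real assume "0 < t" "t < 1"
    have "z + ((1 - t) *\<^sub>R a + t *\<^sub>R b) *\<^sub>R (v - z)
        = (1 - t) *\<^sub>R (z + a *\<^sub>R (v - z)) + t *\<^sub>R (z + b *\<^sub>R (v - z))"
      by (simp add: algebra_simps)
    then show "?\<phi> ((1 - t) *\<^sub>R a + t *\<^sub>R b) \<le> (1 - t) * ?\<phi> a + t * ?\<phi> b"
      using convex_onD[OF conv, of t "z + a *\<^sub>R (v - z)" "z + b *\<^sub>R (v - z)"] \<open>0 < t\<close> \<open>t < 1\<close>
      by simp
  qed simp
  from convex_on_imp_above_tangent[OF this, of 0 1 "df z \<bullet> (v - z)"]
  show ?thesis using GDERIV_along_line[OF deriv, of z "v - z" 0] by simp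
qed

text \<open>Along the segment, the function minus its quadratic bound has a nonpositive derivative,
  by Cauchy-Schwarz and the Lipschitz gradient.\<close>

lemma lipschitz_gradient_descent:
  fixes f :: "'h::real_inner \<Rightarrow> real"
  assumes deriv: "\<And>z. GDERIV f z :> df z" and lip: "L-lipschitz_on UNIV df"
  shows "f v \<le> f z + df z \<bullet> (v - z) + L / 2 * (norm (v - z))\<^sup>2"
proof -
  define d where "d = v - z"
  define \<phi> where "\<phi> s = f (z + s *\<^sub>R d) - s * (df z \<bullet> d) - L / 2 * s\<^sup>2 * (norm d)\<^sup>2" for s
  have "\<phi> 1 \<le> \<phi> 0"
  proof (rule DERIV_nonpos_imp_nonincreasing[where f=\<phi> and a=0 and b=1])
    fix s :: real assume "0 \<le> s"
    have "(\<phi> has_real_derivative df (z + s *\<^sub>R d) \<bullet> d - df z \<bullet> d - L * s * (norm d)\<^sup>2) (at s)"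
      unfolding \<phi>_def by (rule derivative_eq_intros GDERIV_along_line[OF deriv] refl | simp)+
    moreover have "(df (z + s *\<^sub>R d) - df z) \<bullet> d \<le> (L * (s * norm d)) * norm d"
    proof -
      have "norm (df (z + s *\<^sub>R d) - df z) \<le> L * (s * norm d)"
        using lipschitz_onD[OF lip, of "z + s *\<^sub>R d" z] \<open>0 \<le> s\<close> by (simp add: dist_norm)
      then show ?thesis
        using norm_cauchy_schwarz[of "df (z + s *\<^sub>R d) - df z" d]
          mult_right_mono[OF _ norm_ge_zero[of d]] by (meson order_trans)
    qed
    then have "df (z + s *\<^sub>R d) \<bullet> d - df z \<bullet> d - L * s * (norm d)\<^sup>2 \<le> 0"
      by (simp add: inner_diff_left power2_eq_square)
    ultimately show "\<exists>y. (\<phi> has_real_derivative y) (at s) \<and> y \<le> 0" by blast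
  qed simp
  then show ?thesis by (simp add: \<phi>_def d_def)
qed

section \<open>Convergence of the accelerated gradient method\<close>

context
  fixes \<Phi> :: "'h::real_inner \<Rightarrow> real" and D :: "'h \<Rightarrow> 'h" and L :: real
    and x y :: "nat \<Rightarrow> 'h" and t :: "nat \<Rightarrow> real"
  assumes L: "L > 0"
    and tangent: "\<And>z v. \<Phi> z + D z \<bullet> (v - z) \<le> \<Phi> v"
    and descent: "\<And>z v. \<Phi> v \<le> \<Phi> z + D z \<bullet> (v - z) + L / 2 * (norm (v - z))\<^sup>2"
    and t1: "t 1 = 1" and y1: "y 1 = x 0"
    and x_step: "\<And>k. k \<ge> 1 \<Longrightarrow> x k = y k - (1 / L) *\<^sub>R D (y k)"
    and t_step: "\<And>k. k \<ge> 1 \<Longrightarrow> t (k + 1) = (1 + sqrt (1 + 4 * (t k)\<^sup>2)) / 2"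
    and y_step: "\<And>k. k \<ge> 1 \<Longrightarrow> y (k + 1) = x k + ((t k - 1) / t (k + 1)) *\<^sub>R (x k - x (k - 1))"
begin

text \<open>Adds the descent bound from \<open>y k\<close> to \<open>x k\<close> and the tangent
  bound from \<open>y k\<close> to \<open>v\<close>, with \<open>D (y k)\<close> expressed by the
  step taken.\<close>

lemma fista_prox_inequality:
  assumes "k \<ge> 1"
  shows "\<Phi> (x k) - \<Phi> v \<le> L * ((y k - x k) \<bullet> (y k - v)) - L / 2 * (norm (y k - x k))\<^sup>2"
proof -
  have D: "D (y k) = L *\<^sub>R (y k - x k)" using x_step[OF assms] L by simp
  show ?thesis
    using tangent[of "y k" v] descent[of "x k" "y k"] unfolding D power2_norm_eq_inner
    by (simp add: inner_simps inner_commute algebra_simps)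
qed

lemma fista_t_ge: "k \<ge> 1 \<Longrightarrow> t k \<ge> (real k + 1) / 2"
proof (induction k rule: dec_induct)
  case (step k)
  have "0 \<le> (real k + 1) / 2" by simp
  also have "\<dots> \<le> t k" by (rule step.IH)
  finally have "0 \<le> t k" .
  then have "2 * t k \<le> sqrt (1 + 4 * (t k)\<^sup>2)" by (intro real_le_rsqrt) (simp add: power_mult_distrib)
  then show ?case using t_step[of k] step by simp
qed (use t1 in simp)

text \<open>The update of \<open>t\<close> is the positive root of \<open>s^2 - s = (t k)^2\<close>,
  which makes the Lyapunov estimate telescope.\<close>

lemma fista_t_square:
  assumes "k \<ge> 1"
  shows "(t (k + 1))\<^sup>2 - t (k + 1) = (t k)\<^sup>2"
proof -
  have "(2 * t (k + 1) - 1)\<^sup>2 = 1 + 4 * (t k)\<^sup>2"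
    unfolding t_step[OF assms] by (simp add: field_simps)
  then show ?thesis by (simp add: power2_eq_square algebra_simps)
qed

text \<open>The left side is a Lyapunov function: it does not increase with \<open>k\<close>, and
  the prox inequality bounds its first value.\<close>

lemma fista_lyapunov:
  assumes "k \<ge> 1"
  shows "(t k)\<^sup>2 * (\<Phi> (x k) - \<Phi> v) + L / 2 * (norm (t k *\<^sub>R x k - (t k - 1) *\<^sub>R x (k - 1) - v))\<^sup>2
    \<le> L / 2 * (norm (x 0 - v))\<^sup>2"
  using assms
proof (induction k rule: dec_induct)
  case base
  show ?case
    using fista_prox_inequality[of 1 v] unfolding t1 y1 power2_norm_eq_inner
    by (simp add: inner_simps inner_commute algebra_simps)
next
  case (step k)
  define \<tau> where "\<tau> = t (k + 1)"
  define e where "e = y (k + 1) - x (k + 1)"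
  define u where "u = t k *\<^sub>R x k - (t k - 1) *\<^sub>R x (k - 1) - v"
  have "\<tau> \<ge> 1" using fista_t_ge[of "k + 1"] step by (simp add: \<tau>_def)
  have \<tau>2: "\<tau>\<^sup>2 - \<tau> = (t k)\<^sup>2" using fista_t_square step by (simp add: \<tau>_def)
  have "0 \<le> \<tau>\<^sup>2 - \<tau>" unfolding \<tau>2 by simp
  \<comment> \<open>The momentum coefficient is chosen so that extrapolating from \<open>x k\<close>
    through \<open>y (k + 1)\<close> reaches the same point as extrapolating from
    \<open>x (k - 1)\<close> through \<open>x k\<close>.\<close>
  have uy: "\<tau> *\<^sub>R y (k + 1) - (\<tau> - 1) *\<^sub>R x k - v = u"
  proof -
    have "y (k + 1) = x k + ((t k - 1) / \<tau>) *\<^sub>R (x k - x (k - 1))"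
      unfolding \<tau>_def using y_step step by blast
    then have "\<tau> *\<^sub>R y (k + 1) = \<tau> *\<^sub>R x k + (t k - 1) *\<^sub>R (x k - x (k - 1))"
      using \<open>\<tau> \<ge> 1\<close> by (simp add: scaleR_add_right)
    then show ?thesis by (simp add: u_def algebra_simps)
  qed
  \<comment> \<open>The prox inequality at \<open>x k\<close> and at \<open>v\<close>, with weights
    that sum to \<open>\<tau>^2\<close>; the first weight equals \<open>(t k)^2\<close>, so the old
    gap reappears with its old weight.\<close>
  have "(\<tau>\<^sup>2 - \<tau>) * (\<Phi> (x (k + 1)) - \<Phi> (x k)) + \<tau> * (\<Phi> (x (k + 1)) - \<Phi> v)
    \<le> (\<tau>\<^sup>2 - \<tau>) * (L * (e \<bullet> (y (k + 1) - x k)) - L / 2 * (norm e)\<^sup>2)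
      + \<tau> * (L * (e \<bullet> (y (k + 1) - v)) - L / 2 * (norm e)\<^sup>2)"
    using \<open>\<tau> \<ge> 1\<close> \<open>0 \<le> \<tau>\<^sup>2 - \<tau>\<close> fista_prox_inequality[of "k + 1"] unfolding e_def
    by (intro add_mono mult_left_mono) auto
  \<comment> \<open>Both inner products combine to \<open>L * \<tau> * (e \<bullet> u)\<close>, and
    the square is completed.\<close>
  also have "\<dots> = L / 2 * (norm u)\<^sup>2 - L / 2 * (norm (u - \<tau> *\<^sub>R e))\<^sup>2"
    unfolding uy[symmetric] power2_norm_eq_inner
    by (simp add: inner_simps inner_commute field_simps power2_eq_square)
  also have "u - \<tau> *\<^sub>R e = \<tau> *\<^sub>R x (k + 1) - (\<tau> - 1) *\<^sub>R x k - v"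
    unfolding uy[symmetric] e_def by (simp add: algebra_simps)
  finally have "\<tau>\<^sup>2 * (\<Phi> (x (k + 1)) - \<Phi> v)
      + L / 2 * (norm (\<tau> *\<^sub>R x (k + 1) - (\<tau> - 1) *\<^sub>R x k - v))\<^sup>2
    \<le> (\<tau>\<^sup>2 - \<tau>) * (\<Phi> (x k) - \<Phi> v) + L / 2 * (norm u)\<^sup>2"
    by (simp add: algebra_simps)
  also have "\<dots> \<le> L / 2 * (norm (x 0 - v))\<^sup>2" using step.IH by (simp add: \<tau>2 u_def)
  finally show ?case by (simp add: \<tau>_def)
qed

lemma fista_rate:
  assumes "k \<ge> 1"
  shows "\<Phi> (x k) - \<Phi> v \<le> 2 * L * (norm (x 0 - v))\<^sup>2 / (real k)\<^sup>2"
proof -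
  have t: "t k \<ge> real k / 2" using fista_t_ge[OF assms] by argo
  moreover have "real k / 2 > 0" using assms by simp
  ultimately have "t k > 0" by linarith
  have "0 \<le> L / 2 * (norm (t k *\<^sub>R x k - (t k - 1) *\<^sub>R x (k - 1) - v))\<^sup>2" using L by simp
  with fista_lyapunov[OF assms, of v]
  have "(t k)\<^sup>2 * (\<Phi> (x k) - \<Phi> v) \<le> L / 2 * (norm (x 0 - v))\<^sup>2" by linarith
  then have "\<Phi> (x k) - \<Phi> v \<le> L / 2 * (norm (x 0 - v))\<^sup>2 / (t k)\<^sup>2"
    using \<open>t k > 0\<close> by (simp add: field_simps)
  also have "\<dots> \<le> L / 2 * (norm (x 0 - v))\<^sup>2 / (real k / 2)\<^sup>2"
    using t \<open>t k > 0\<close> assms L by (intro divide_left_mono power_mono mult_nonneg_nonneg) auto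
  also have "\<dots> = 2 * L * (norm (x 0 - v))\<^sup>2 / (real k)\<^sup>2"
    using assms by (simp add: field_simps)
  finally show ?thesis .
qed

end

section \<open>Rate for the original objective and choice of the constant\<close>

text \<open>The smoothing error enters once: the envelope lies below \<open>g\<close>, so passing to
  it costs nothing at \<open>v\<close> and \<open>\<mu> * Lg^2 / 2\<close> at
  \<open>x k\<close>.\<close>

lemma smoothing_algorithm_rate:
  fixes f :: "'h::{real_inner, complete_space} \<Rightarrow> real"
    and g :: "'k::{real_inner, complete_space} \<Rightarrow> real"
  assumes convf: "convex_on UNIV f" and deriv: "\<And>z. GDERIV f z :> df z"
    and lipf: "Lf-lipschitz_on UNIV df"
    and convg: "convex_on UNIV g" and lipg: "Lg-lipschitz_on UNIV g"
    and K: "bounded_linear K" and "K \<noteq> (\<lambda>_. 0)" and \<mu>: "\<mu> > 0"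
    and gen: "generated_by_smoothing df Lf g K \<mu> x0 x y t" and "k \<ge> 1"
  shows "objective f g K (x k) - objective f g K v
    \<le> 2 * (Lf + (onorm K)\<^sup>2 / \<mu>) * (norm (x0 - v))\<^sup>2 / (real k)\<^sup>2 + \<mu> * Lg\<^sup>2 / 2"
proof -
  define L where "L = Lf + (onorm K)\<^sup>2 / \<mu>"
  define \<Phi> where "\<Phi> z = f z + smoothing \<mu> g (K z)" for z
  define D where "D z = df z + adjoint K (smooth_grad \<mu> g (K z))" for z
  interpret K: bounded_linear K by fact
  \<comment> \<open>A nonzero \<open>K\<close> keeps \<open>L\<close> positive even when
    \<open>Lf = 0\<close>.\<close>
  have "onorm K > 0" using onorm_pos_lt[OF K] \<open>K \<noteq> (\<lambda>_. 0)\<close> by auto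
  then have "L > 0"
    using lipschitz_on_nonneg[OF lipf] \<mu> unfolding L_def by (intro add_nonneg_pos) auto
  have inner_D: "D z \<bullet> (u - z) = df z \<bullet> (u - z) + smooth_grad \<mu> g (K z) \<bullet> (K u - K z)" for z u
    by (simp add: D_def inner_add_left inner_adjoint[OF K] K.diff)
  have tangent: "\<Phi> z + D z \<bullet> (u - z) \<le> \<Phi> u" for z u
    using convex_on_above_tangent_GDERIV[OF convf deriv, of z u]
      smoothing_above_tangent[OF convg lipg \<mu>, of "K z" "K u"]
    by (simp add: \<Phi>_def inner_D)
  have descent: "\<Phi> u \<le> \<Phi> z + D z \<bullet> (u - z) + L / 2 * (norm (u - z))\<^sup>2" for z u
  proof -
    have "(norm (K u - K z))\<^sup>2 \<le> (onorm K * norm (u - z))\<^sup>2"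
      using onorm[OF K, of "u - z"] by (intro power_mono) (auto simp: K.diff)
    then have "(norm (K u - K z))\<^sup>2 / (2 * \<mu>) \<le> (onorm K)\<^sup>2 / \<mu> / 2 * (norm (u - z))\<^sup>2"
      using \<mu> by (simp add: power_mult_distrib field_simps)
    then show ?thesis
      using lipschitz_gradient_descent[OF deriv lipf, of u z]
        smoothing_descent[OF convg lipg \<mu>, of "K u" "K z"]
      by (simp add: \<Phi>_def inner_D L_def add_divide_distrib distrib_right)
  qed
  have "\<Phi> (x k) - \<Phi> v \<le> 2 * L * (norm (x 0 - v))\<^sup>2 / (real k)\<^sup>2"
    using gen unfolding generated_by_smoothing_def Let_def L_def[symmetric]
    by (intro fista_rate[OF \<open>L > 0\<close> tangent descent _ _ _ _ _ \<open>k \<ge> 1\<close>, where t=t and y=y])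
      (auto simp: D_def smooth_grad_def)
  moreover have "x 0 = x0" using gen by (simp add: generated_by_smoothing_def Let_def)
  ultimately show ?thesis
    using le_smoothing[OF convg lipg \<mu>, of "K (x k)"] smoothing_le[OF convg lipg \<mu>, of "K v"]
    unfolding objective_def \<Phi>_def L_def by simp
qed

theorem theorem4:
  fixes f :: "'h::{real_inner, complete_space} \<Rightarrow> real"
    and df :: "'h \<Rightarrow> 'h"
    and g :: "'k::{real_inner, complete_space} \<Rightarrow> real"
    and K :: "'h \<Rightarrow> 'k"
    and Lf Lg :: real
    and xs x0 :: 'h
  assumes "convex_on UNIV f"
    and "\<And>z. GDERIV f z :> df z"
    and "Lf-lipschitz_on UNIV df"
    and "convex_on UNIV g"
    and "Lg > 0"
    and "Lg-lipschitz_on UNIV g"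
    and "bounded_linear K"
    and "K \<noteq> (\<lambda>_. 0)"
    and "\<And>z. objective f g K xs \<le> objective f g K z"
  shows "\<exists>C>0.
      (\<forall>\<epsilon>>0. \<forall>x y t. generated_by_smoothing df Lf g K (\<epsilon> / Lg\<^sup>2) x0 x y t \<longrightarrow>
        (\<forall>k\<ge>1. real k \<ge> C / \<epsilon> \<longrightarrow> objective f g K (x k) - objective f g K xs \<le> \<epsilon>)) \<and>
      (\<forall>k\<ge>1. \<forall>\<epsilon> x y t. \<epsilon> = C / real k \<and> generated_by_smoothing df Lf g K (\<epsilon> / Lg\<^sup>2) x0 x y t \<longrightarrow>
        objective f g K (x k) - objective f g K xs \<le> C / real k)"
proof -
  define R where "R = norm (x0 - xs)"
  define M where "M = onorm K * Lg * R"
  \<comment> \<open>For \<open>\<mu> = \<epsilon> / Lg^2\<close> the rate splits into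
    \<open>2 * Lf * R^2 / k^2\<close> and \<open>2 * M^2 / (\<epsilon> * k^2)\<close>. Each is at
    most \<open>\<epsilon> / 4\<close> for \<open>k \<ge> C / \<epsilon>\<close> if
    \<open>8 * Lf * R^2 \<le> C\<close> and \<open>8 * M^2 \<le> C^2\<close>; 3 overestimates the
    root of 8, and 1 makes \<open>C\<close> positive.\<close>
  define C where "C = 8 * Lf * R\<^sup>2 + 3 * M + 1"
  have "Lf \<ge> 0" using assms(3) by (rule lipschitz_on_nonneg)
  have "M \<ge> 0" using onorm_pos_le[OF assms(7)] \<open>Lg > 0\<close> by (simp add: M_def R_def)
  have C: "C > 0" "8 * Lf * R\<^sup>2 \<le> C" "3 * M \<le> C"
    using \<open>Lf \<ge> 0\<close> \<open>M \<ge> 0\<close> by (auto simp: C_def intro!: add_nonneg_pos)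
  have "(3 * M)\<^sup>2 \<le> C\<^sup>2" using C \<open>M \<ge> 0\<close> by (intro power_mono) auto
  moreover have "(3 * M)\<^sup>2 = 9 * M\<^sup>2" "0 \<le> M\<^sup>2" by (simp_all add: power_mult_distrib)
  ultimately have CM: "8 * M\<^sup>2 \<le> C\<^sup>2" by linarith
  have main: "objective f g K (x k) - objective f g K xs \<le> \<epsilon>"
    if "\<epsilon> > 0" and gen: "generated_by_smoothing df Lf g K (\<epsilon> / Lg\<^sup>2) x0 x y t"
      and "k \<ge> 1" and k: "real k \<ge> C / \<epsilon>" for \<epsilon> x y t and k :: nat
  proof -
    have "real k > 0" using \<open>k \<ge> 1\<close> by simp
    have C_le: "C \<le> \<epsilon> * real k" using k \<open>\<epsilon> > 0\<close> by (simp add: field_simps)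
    have "8 * Lf * R\<^sup>2 \<le> \<epsilon> * (real k)\<^sup>2"
    proof -
      have "8 * Lf * R\<^sup>2 \<le> \<epsilon> * real k * 1" using C C_le by simp
      also have "\<dots> \<le> \<epsilon> * real k * real k"
        using \<open>\<epsilon> > 0\<close> \<open>k \<ge> 1\<close> by (intro mult_left_mono) auto
      finally show ?thesis by (simp add: power2_eq_square mult.assoc)
    qed
    then have 1: "2 * Lf * R\<^sup>2 / (real k)\<^sup>2 \<le> \<epsilon> / 4" using \<open>real k > 0\<close> by (simp add: field_simps)
    have "C\<^sup>2 \<le> (\<epsilon> * real k)\<^sup>2" using C C_le by (intro power_mono) auto
    with CM have "8 * M\<^sup>2 \<le> \<epsilon> * (\<epsilon> * (real k)\<^sup>2)"
      by (simp add: power_mult_distrib power2_eq_square ac_simps)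
    then have 2: "2 * M\<^sup>2 / (\<epsilon> * (real k)\<^sup>2) \<le> \<epsilon> / 4"
      using \<open>real k > 0\<close> \<open>\<epsilon> > 0\<close> by (simp add: field_simps)
    have "objective f g K (x k) - objective f g K xs
        \<le> 2 * (Lf + (onorm K)\<^sup>2 / (\<epsilon> / Lg\<^sup>2)) * R\<^sup>2 / (real k)\<^sup>2 + \<epsilon> / Lg\<^sup>2 * Lg\<^sup>2 / 2"
      unfolding R_def using \<open>\<epsilon> > 0\<close> \<open>Lg > 0\<close>
      by (intro smoothing_algorithm_rate[OF assms(1-4,6-8) _ gen \<open>k \<ge> 1\<close>]) simp
    also have "\<dots> = 2 * Lf * R\<^sup>2 / (real k)\<^sup>2 + 2 * M\<^sup>2 / (\<epsilon> * (real k)\<^sup>2) + \<epsilon> / 2"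
      using \<open>\<epsilon> > 0\<close> \<open>Lg > 0\<close> \<open>real k > 0\<close>
      by (simp add: M_def power_mult_distrib add_divide_distrib distrib_right distrib_left ac_simps)
    finally show ?thesis using 1 2 by simp
  qed
  show ?thesis
  proof (intro exI[of _ C] conjI allI impI)
    \<comment> \<open>The choice \<open>\<epsilon> = C / k\<close> is the equality case of
      \<open>k \<ge> C / \<epsilon>\<close>.\<close>
    fix k :: nat and \<epsilon> x y t
    assume "k \<ge> 1" and *: "\<epsilon> = C / real k \<and> generated_by_smoothing df Lf g K (\<epsilon> / Lg\<^sup>2) x0 x y t"
    then have "\<epsilon> > 0" "real k \<ge> C / \<epsilon>" using C(1) by auto
    with main[of \<epsilon> x y t k] * \<open>k \<ge> 1\<close>
    show "objective f g K (x k) - objective f g K xs \<le> C / real k" by metis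
  qed (use C(1) main in auto)
qed

end
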